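(* Let $d\ge 2$, let $X=\{x_1,x_2\}$ be a list of two items with unit-norm feature vectors $x_1,x_2\in\mathbb{R}^d$, and let $U_1,U_2$ be the finite sets of users associated with items $1$ and $2$, respectively. Suppose $U_1$ and $U_2$ differ only in a single user: there are a finite set of users $U$ with $|U|>1$ and two distinct users $a_1,a_2\notin U$ such that $U_1=U\cup\{a_1\}$ and $U_2=U\cup\{a_2\}$. Let the modification cost scale be $\alpha=0$. Then there exists an $f$, i.e. an assignment of unit-norm embeddings in $\mathbb{R}^d$ to the users in $U\cup\{a_1,a_2\}$ (with $v_1\neq0$, $v_2\ne 0$), for which the strategically modified list $X^f=(\Delta_f(x_1),\Delta_f(x_2))$ attains maximal diversity, $\mathrm{div}(X^f,r^f)=1$.
   Context: There are finitely many users and items. Each item $j$ has a feature vector $x_j\in\mathbb{R}^d$ with $\|x_j\|_2=1$, and is associated with a finite nonempty set $U_j$ of users. A model $f$ is given by an assignment of an embedding $u_i\in\mathbb{R}^d$ with $\|u_i\|_2=1$ to every user $i$ (different users may receive equal embeddings); the score of item $x$ for user $i$ is $f(x;u_i)=u_i^\top x$. Average user of item $j$: $v_j=\frac{1}{|U_j|}\sum_{i\in U_j}u_i$ and $\tilde v_j=v_j/\|v_j\|_2$ (defined when $v_j\neq 0$). Best response of item $j$ with cost scale $\alpha\ge 0$: $\Delta_f(x_j)=\operatorname{argmax}_{x'\in\mathbb{R}^d,\ \|x'\|_2=1}\ \tilde v_j^\top x'-\alpha\|x_j-x'\|_2^2$. In this result $\alpha=0$, so $\Delta_f(x_j)$ is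 the unit vector maximizing $\tilde v_j^\top x'$. Diversity of a list of two unit-norm items $(z_1,z_2)$, both recommended, so that the ranking $r$ plays no role: $\mathrm{div}((z_1,z_2),r)=\frac{1-z_1^\top z_2}{2}\in[0,1]$. $r^f$ denotes the ranking of $X^f$ by score. *)

theory Defs
  imports "HOL-Analysis.Analysis"
begin

text \<open>
  A model \<open>f\<close> is represented by its user embeddings \<open>u\<close>; only the values of \<open>u\<close> on the users
  that occur are relevant. An item is a pair of a feature vector and its set of users.
\<close>

definition score :: "'v::real_inner \<Rightarrow> 'v \<Rightarrow> real" where
  "score w x = w \<bullet> x"

definition avg_user :: "('u \<Rightarrow> 'v::real_inner) \<Rightarrow> 'u set \<Rightarrow> 'v" where
  "avg_user u S = (1 / real (card S)) *\<^sub>R (\<Sum>i\<in>S. u i)"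

text \<open>Meaningful only if \<open>avg_user u S \<noteq> 0\<close>.\<close>

definition normalized_avg_user :: "('u \<Rightarrow> 'v::real_inner) \<Rightarrow> 'u set \<Rightarrow> 'v" where
  "normalized_avg_user u S = (1 / norm (avg_user u S)) *\<^sub>R avg_user u S"

definition item_payoff :: "('u \<Rightarrow> 'v::real_inner) \<Rightarrow> real \<Rightarrow> 'v \<times> 'u set \<Rightarrow> 'v \<Rightarrow> real" where
  "item_payoff u \<alpha> = (\<lambda>(x, S) x'. normalized_avg_user u S \<bullet> x' - \<alpha> * (norm (x - x'))\<^sup>2)"

definition best_response :: "('u \<Rightarrow> 'v::real_inner) \<Rightarrow> real \<Rightarrow> 'v \<times> 'u set \<Rightarrow> 'v" where
  "best_response u \<alpha> item = arg_max (item_payoff u \<alpha> item) (\<lambda>x'. norm x' = 1)"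

definition modified_list :: "('u \<Rightarrow> 'v::real_inner) \<Rightarrow> real \<Rightarrow> ('v \<times> 'u set) list \<Rightarrow> 'v list" where
  "modified_list u \<alpha> items = map (best_response u \<alpha>) items"

text \<open>For each user, the list positions in order of decreasing score (ties broken by position).\<close>

definition score_ranking :: "('u \<Rightarrow> 'v::real_inner) \<Rightarrow> 'v list \<Rightarrow> 'u \<Rightarrow> nat list" where
  "score_ranking u X = (\<lambda>i. sort_key (\<lambda>j. - score (u i) (X ! j)) [0..<length X])"

text \<open>
  Diversity of a list of exactly two items. Both are recommended, so the ranking \<open>r\<close>
  does not enter the value.
\<close>

definition diversity :: "'v::real_inner list \<Rightarrow> ('u \<Rightarrow> nat list) \<Rightarrow> real" where
  "diversity X r = (1 - (X ! 0) \<bullet> (X ! 1)) / 2"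

text \<open>
  The library operator \<open>arg_max\<close> chooses some maximizer if there is one. The following lemmas
  show that one always exists, and that for cost scale zero it is unique.
\<close>

lemma best_response_is_arg_max:
  fixes u :: "'u \<Rightarrow> 'v::euclidean_space"
  shows "is_arg_max (item_payoff u \<alpha> item) (\<lambda>x'. norm x' = 1) (best_response u \<alpha> item)"
proof -
  obtain x S where item: "item = (x, S)" by fastforce
  have "continuous_on (sphere 0 1) (item_payoff u \<alpha> item)"
    unfolding item_payoff_def item by (auto intro!: continuous_intros)
  then obtain z where "z \<in> sphere 0 1"
      "\<forall>y\<in>sphere 0 1. item_payoff u \<alpha> item y \<le> item_payoff u \<alpha> item z"
    using continuous_attains_sup[of "sphere (0::'v) 1"] by force
  then have "is_arg_max (item_payoff u \<alpha> item) (\<lambda>x'. norm x' = 1) z"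
    by (auto simp: is_arg_max_linorder)
  then show ?thesis
    unfolding best_response_def arg_max_def by (rule someI)
qed

lemma best_response_unique_zero_cost:
  fixes u :: "'u \<Rightarrow> 'v::real_inner"
  assumes "avg_user u S \<noteq> 0"
    and "is_arg_max (item_payoff u 0 (x, S)) (\<lambda>x'. norm x' = 1) z"
  shows "z = normalized_avg_user u S"
proof -
  let ?w = "normalized_avg_user u S"
  have w: "norm ?w = 1"
    using assms(1) by (simp add: normalized_avg_user_def)
  have z: "norm z = 1" and "?w \<bullet> ?w \<le> ?w \<bullet> z"
    using assms(2) w by (auto simp: is_arg_max_linorder item_payoff_def)
  then have "1 \<le> ?w \<bullet> z"
    using w by (simp add: norm_eq_1)
  moreover have "(norm (z - ?w))\<^sup>2 = 2 - 2 * (?w \<bullet> z)"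
    using w z by (simp add: power2_norm_eq_inner inner_diff inner_commute norm_eq_1)
  ultimately have "(norm (z - ?w))\<^sup>2 \<le> 0" by simp
  then show ?thesis by simp
qed

end

theory Submission
  imports Defs
begin

text \<open>
  Let the common users be the roots of unity of order \<open>card U\<close> in a plane, so that their
  embeddings cancel, and give the two remaining users opposite embeddings \<open>e\<close> and \<open>- e\<close>. The
  normalized average users are then \<open>e\<close> and \<open>- e\<close>, and at cost zero these are the best responses.
\<close>

text \<open>Since \<open>e\<close> and \<open>e'\<close> are orthonormal, sending z to Re z times
  \<open>e\<close> plus Im z times \<open>e'\<close> is a real-linear isometry of the complex plane
  into the space. Linearity carries over the zero sum of the roots of unity, isometry their unit
  norm.\<close>

lemma unit_vectors_sum_zero:
  fixes e e' :: "'v::real_inner"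
  assumes "norm e = 1" "norm e' = 1" "e \<bullet> e' = 0" and "finite U" "card U > 1"
  obtains w :: "'u \<Rightarrow> 'v" where "\<And>i. i \<in> U \<Longrightarrow> norm (w i) = 1" "(\<Sum>i\<in>U. w i) = 0"
proof -
  let ?R = "{z::complex. z ^ card U = 1}"
  have "card ?R = card U" "finite ?R"
    using assms card_roots_unity_eq[of "card U"] finite_roots_unity[of "card U"] by auto
  with assms obtain h where h: "bij_betw h U ?R"
    using finite_same_card_bij[of U ?R] by metis
  define w where "w i = Re (h i) *\<^sub>R e + Im (h i) *\<^sub>R e'" for i
  have "(\<Sum>i\<in>U. h i) = \<Sum>?R"
    using sum.reindex_bij_betw[OF h, of "\<lambda>z. z"] by simp
  \<comment> \<open>This is where \<open>card U > 1\<close> matters: the only root of unity of order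
    1 is 1, whose sum is not zero.\<close>
  also have "\<dots> = 0"
    using assms by (intro sum_roots_unity) auto
  finally have "(\<Sum>i\<in>U. h i) = 0" .
  moreover have "(\<Sum>i\<in>U. w i) = Re (\<Sum>i\<in>U. h i) *\<^sub>R e + Im (\<Sum>i\<in>U. h i) *\<^sub>R e'"
    by (simp add: w_def sum.distrib scaleR_sum_left)
  ultimately have "(\<Sum>i\<in>U. w i) = 0" by simp
  moreover have "norm (w i) = 1" if "i \<in> U" for i
  proof -
    have "h i ^ card U = 1" using h that by (auto simp: bij_betw_def)
    then have "norm (h i) ^ card U = 1 ^ card U" by (simp flip: norm_power)
    then have "norm (h i) = 1" using assms by (metis gr_implies_not0 norm_ge_zero power_eq_imp_eq_base zero_le_one gr0I)
    then have "(Re (h i))\<^sup>2 + (Im (h i))\<^sup>2 = 1" by (simp add: cmod_def)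
    moreover have "w i \<bullet> w i = (Re (h i))\<^sup>2 + (Im (h i))\<^sup>2"
      using assms by (simp add: w_def inner_add inner_commute norm_eq_1 power2_eq_square)
    ultimately show ?thesis by (simp add: norm_eq_1)
  qed
  ultimately show thesis using that by blast
qed

lemma best_response_zero_cost:
  fixes u :: "'u \<Rightarrow> 'v::euclidean_space"
  assumes "avg_user u S \<noteq> 0"
  shows "best_response u 0 (x, S) = normalized_avg_user u S"
  using assms best_response_is_arg_max by (rule best_response_unique_zero_cost)

text \<open>The common users cancel, so only \<open>u a\<close> survives, with a positive factor
  that normalization removes.\<close>

lemma avg_user_insert_sum_zero:
  assumes "finite U" "a \<notin> U" "(\<Sum>i\<in>U. u i) = 0"
  shows "avg_user u (U \<union> {a}) = (1 / real (Suc (card U))) *\<^sub>R u a"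
  using assms by (simp add: avg_user_def)

lemma normalized_avg_user_insert_sum_zero:
  assumes "finite U" "a \<notin> U" "(\<Sum>i\<in>U. u i) = 0" "norm (u a) = 1"
  shows "normalized_avg_user u (U \<union> {a}) = u a"
  unfolding normalized_avg_user_def avg_user_insert_sum_zero[OF assms(1-3)]
  using assms(4) by simp

theorem proposition2:
  fixes x1 x2 :: "real ^ 'n"
    and U U1 U2 :: "'u set"
    and a1 a2 :: 'u
  assumes "CARD('n) \<ge> 2"
    and "norm x1 = 1" and "norm x2 = 1"
    and "finite U" and "card U > 1"
    and "a1 \<notin> U" and "a2 \<notin> U" and "a1 \<noteq> a2"
    and "U1 = U \<union> {a1}" and "U2 = U \<union> {a2}"
  shows "\<exists>u :: 'u \<Rightarrow> real ^ 'n.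
           (\<forall>i \<in> U \<union> {a1, a2}. norm (u i) = 1) \<and>
           avg_user u U1 \<noteq> 0 \<and> avg_user u U2 \<noteq> 0 \<and>
           (let X' = modified_list u 0 [(x1, U1), (x2, U2)]
            in diversity X' (score_ranking u X') = 1)"
proof -
  \<comment> \<open>Two distinct coordinates supply the orthonormal pair spanning the plane of the
    common users.\<close>
  obtain j k :: 'n where "j \<noteq> k"
    using assms(1) card_2_iff' ex_card[of 2 "UNIV :: 'n set"] by metis
  define e :: "real ^ 'n" where "e = axis j 1"
  have e: "norm e = 1" by (simp add: e_def)
  have "norm (axis k 1 :: real ^ 'n) = 1" "e \<bullet> axis k 1 = 0"
    using \<open>j \<noteq> k\<close> by (auto simp: e_def inner_axis_axis)
  then obtain w :: "'u \<Rightarrow> real ^ 'n"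
    where w: "\<And>i. i \<in> U \<Longrightarrow> norm (w i) = 1" "(\<Sum>i\<in>U. w i) = 0"
    using unit_vectors_sum_zero[OF e] assms(4,5) by metis
  define u where "u = w(a1 := e, a2 := - e)"
  have ua: "u a1 = e" "u a2 = - e" using assms(8) by (auto simp: u_def)
  have uU: "u i = w i" if "i \<in> U" for i using that assms(6,7) by (auto simp: u_def)
  have sum0: "(\<Sum>i\<in>U. u i) = 0" using w(2) uU by simp
  have unit: "\<forall>i \<in> U \<union> {a1, a2}. norm (u i) = 1" using w(1) uU ua e by auto
  have nz: "avg_user u U1 \<noteq> 0" "avg_user u U2 \<noteq> 0"
    using avg_user_insert_sum_zero[OF assms(4) _ sum0] assms(6,7,9,10) ua e by auto
  have "normalized_avg_user u U1 = e" "normalized_avg_user u U2 = - e"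
    using normalized_avg_user_insert_sum_zero[OF assms(4) _ sum0] assms(6,7,9,10) ua e by auto
  \<comment> \<open>At cost zero the payoff ignores the original features, so \<open>x1\<close> and
    \<open>x2\<close> drop out.\<close>
  then have "modified_list u 0 [(x1, U1), (x2, U2)] = [e, - e]"
    using nz by (simp add: modified_list_def best_response_zero_cost)
  \<comment> \<open>The inner product of \<open>e\<close> and \<open>- e\<close> is -1, its least
    possible value for unit vectors.\<close>
  moreover have "diversity [e, - e] r = 1" for r :: "'u \<Rightarrow> nat list"
    using e by (simp add: diversity_def norm_eq_1)
  ultimately show ?thesis using unit nz by (auto simp: Let_def)
qed

end
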